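(* Let $n,m\ge 1$ and $t_0<t_f$ be given, and for $t\in[t_0,t_f]$ let $A(t)\in\mathbb{R}^{n\times n}$, $B(t)\in\mathbb{R}^{n\times m}$, $Q(t)\in\mathbb{R}^{n\times n}$ symmetric with $Q(t)\succeq 0$, $R(t)\in\mathbb{R}^{m\times m}$ symmetric with $R(t)\succ 0$, and let $F(t_f)\in\mathbb{R}^{n\times n}$ be symmetric. Let $P:[t_0,t_f]\to\mathbb{R}^{n\times n}$ be a matrix function (not assumed symmetric or positive definite) every entry of which is differentiable at every $t\in[t_0,t_f)$, and choose the Krotov function $q(\boldsymbol{x},t)=\boldsymbol{x}^TP(t)\boldsymbol{x}$. Define $$s(\boldsymbol{x},\boldsymbol{u},t)=\frac{\partial q}{\partial t}(\boldsymbol{x},t)+\frac{\partial q}{\partial \boldsymbol{x}}(\boldsymbol{x},t)\,[A(t)\boldsymbol{x}+B(t)\boldsymbol{u}]+\boldsymbol{x}^TQ(t)\boldsymbol{x}+\boldsymbol{u}^TR(t)\boldsymbol{u},\qquad (\boldsymbol{x},\boldsymbol{u})\in\mathbb{R}^n\times\mathbb{R}^m,\ t\in[t_0,t_f),$$ $$s_f(\boldsymbol{x})=\boldsymbol{x}^TF(t_f)\boldsymbol{x}-q(\boldsymbol{x},t_f),\qquad \boldsymbol{x}\in\mathbb{R}^n .$$ Then the following statements are equivalent: (a) For every $t\in[t_0,t_f)$ the function $(\boldsymbol{x},\boldsymbol{u})\mapsto s(\boldsymbol{x},\boldsymbol{u},t)$ is convex on $\mathbb{R}^n\times\mathbb{R}^m$,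 and $s_f$ is convex on $\mathbb{R}^n$. (b) $P$ satisfies the matrix inequalities (i) $\dot P+PA+A^TP+Q-\tfrac12 PBR^{-1}B^TP-\tfrac14 PBR^{-1}B^TP^T-\tfrac14 P^TBR^{-1}B^TP\succeq 0$ for all $t\in[t_0,t_f)$ (all matrices evaluated at $t$); (ii) $F(t_f)-P(t_f)\succeq 0$.
   Context: Convention: for a real square matrix $M$, not necessarily symmetric, $M\succeq 0$ means $\boldsymbol{x}^TM\boldsymbol{x}\ge 0$ for all real vectors $\boldsymbol{x}$, and $M\succ 0$ means $\boldsymbol{x}^TM\boldsymbol{x}> 0$ for all $\boldsymbol{x}\neq 0$. The gradient $\partial q/\partial\boldsymbol{x}$ is a row vector, so here $\partial q/\partial\boldsymbol{x}=\boldsymbol{x}^T(P+P^T)$. $\dot P$ denotes the entrywise time derivative (one-sided at $t_0$). Background: the functions $s$ and $s_f$ are those associated by Krotov's method with the finite-horizon linear quadratic regulator problem of minimizing $\boldsymbol{x}^T(t_f)F(t_f)\boldsymbol{x}(t_f)+\int_{t_0}^{t_f}(\boldsymbol{x}^TQ\boldsymbol{x}+\boldsymbol{u}^TR\boldsymbol{u})\,dt$ subject to $\dot{\boldsymbol{x}}=A(t)\boldsymbol{x}+B(t)\boldsymbol{u}$, $\boldsymbol{x}(t_0)=\boldsymbol{x}_0$. *)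

theory Defs
  imports "HOL-Analysis.Analysis"
begin

text \<open>Semidefiniteness and definiteness of a quadratic form; the matrix need not be symmetric.\<close>

definition psd :: "real^'n^'n \<Rightarrow> bool" where
  "psd M \<longleftrightarrow> (\<forall>x. x \<bullet> (M *v x) \<ge> 0)"

definition pd :: "real^'n^'n \<Rightarrow> bool" where
  "pd M \<longleftrightarrow> (\<forall>x. x \<noteq> 0 \<longrightarrow> x \<bullet> (M *v x) > 0)"

text \<open>Time derivatives are taken within \<open>{t0..tf}\<close>, hence two-sided at interior points
  and one-sided at \<open>t0\<close>.\<close>

definition entry_deriv :: "real \<Rightarrow> real \<Rightarrow> (real \<Rightarrow> real^'n^'m) \<Rightarrow> real \<Rightarrow> real^'n^'m" where
  "entry_deriv t0 tf P t =
     (\<chi> i j. vector_derivative (\<lambda>\<tau>. P \<tau> $ i $ j) (at t within {t0..tf}))"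

definition time_partial ::
    "real \<Rightarrow> real \<Rightarrow> (real^'n \<Rightarrow> real \<Rightarrow> real) \<Rightarrow> real^'n \<Rightarrow> real \<Rightarrow> real" where
  "time_partial t0 tf q x t = vector_derivative (\<lambda>\<tau>. q x \<tau>) (at t within {t0..tf})"

text \<open>The row vector of partial derivatives in the state variables; its product with a
  column vector is written with the inner product.\<close>

definition state_gradient :: "(real^'n \<Rightarrow> real \<Rightarrow> real) \<Rightarrow> real^'n \<Rightarrow> real \<Rightarrow> real^'n" where
  "state_gradient q x t = (\<chi> i. deriv (\<lambda>h. q (x + h *\<^sub>R axis i 1) t) 0)"

text \<open>The functions that Krotov's method associates with a Krotov function \<open>q\<close> and the
  linear quadratic regulator problem.\<close>

definition krotov_s ::
    "real \<Rightarrow> real \<Rightarrow> (real \<Rightarrow> real^'n^'n) \<Rightarrow> (real \<Rightarrow> real^'m^'n) \<Rightarrow>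
     (real \<Rightarrow> real^'n^'n) \<Rightarrow> (real \<Rightarrow> real^'m^'m) \<Rightarrow> (real^'n \<Rightarrow> real \<Rightarrow> real) \<Rightarrow>
     real^'n \<Rightarrow> real^'m \<Rightarrow> real \<Rightarrow> real" where
  "krotov_s t0 tf A B Q R q x u t =
     time_partial t0 tf q x t + state_gradient q x t \<bullet> (A t *v x + B t *v u)
     + x \<bullet> (Q t *v x) + u \<bullet> (R t *v u)"

definition krotov_sf ::
    "real \<Rightarrow> real^'n^'n \<Rightarrow> (real^'n \<Rightarrow> real \<Rightarrow> real) \<Rightarrow> real^'n \<Rightarrow> real" where
  "krotov_sf tf F q x = x \<bullet> (F *v x) - q x tf"

definition quadratic_q :: "(real \<Rightarrow> real^'n^'n) \<Rightarrow> real^'n \<Rightarrow> real \<Rightarrow> real" where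
  "quadratic_q P x t = x \<bullet> (P t *v x)"

end

theory Submission
  imports Defs
begin

text \<open>
  Neither \<open>s(\<cdot>,\<cdot>,t)\<close> nor \<open>s\<^sub>f\<close> has affine terms: each is a quadratic form \<open>z \<bullet> L z\<close> with \<open>L\<close> linear.
  Such a form is convex exactly when it is nonnegative (\<open>convex_on_quadratic_form_iff\<close>), which
  settles \<open>s\<^sub>f\<close> at once.

  For \<open>s\<close>, put \<open>S = P + P\<^sup>T\<close>. The form is
  \<open>x \<bullet> (P' + SA + Q) x + Sx \<bullet> Bu + u \<bullet> Ru\<close>, where \<open>P'\<close> is the time derivative of \<open>P\<close>.
  Since \<open>R\<close> is positive definite, minimizing over \<open>u\<close> is completing the square
  (\<open>quadratic_nonneg_iff_Schur\<close>), so nonnegativity in \<open>(x,u)\<close> amounts to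
  \<open>x \<bullet> (P' + SA + Q - 1/4 S G S) x \<ge> 0\<close> for all \<open>x\<close>, where \<open>G = B R\<^sup>-\<^sup>1 B\<^sup>T\<close>.

  This matrix is not the one of the matrix inequality, but both induce the same quadratic form
  (\<open>krotov_inequality_form\<close>), because a form does not distinguish a matrix from its transpose:
  \<open>P\<^sup>T A\<close> may be traded for \<open>A\<^sup>T P\<close>, and in the expansion of \<open>S G S\<close> the terms \<open>P G P\<close> and
  \<open>P\<^sup>T G P\<^sup>T\<close> contribute equally, which explains the uneven coefficients 1/2, 1/4, 1/4.
\<close>

section \<open>Convexity of quadratic forms\<close>

text \<open>Convexity at the midpoint of \<open>z\<close> and \<open>-z\<close> gives \<open>0 \<le> z \<bullet> L z\<close>. Conversely, the gap in
  the convexity inequality between \<open>x\<close> and \<open>y\<close> with weight \<open>t\<close> is \<open>t (1 - t)\<close> times the form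
  at \<open>x - y\<close>.\<close>

lemma convex_on_quadratic_form_iff:
  fixes L :: "'a::real_inner \<Rightarrow> 'a"
  assumes "linear L"
  shows "convex_on UNIV (\<lambda>z. z \<bullet> L z) \<longleftrightarrow> (\<forall>z. 0 \<le> z \<bullet> L z)"
proof
  assume c: "convex_on UNIV (\<lambda>z. z \<bullet> L z)"
  show "\<forall>z. 0 \<le> z \<bullet> L z"
  proof
    fix z
    show "0 \<le> z \<bullet> L z"
      using convex_onD[OF c, of "1/2" z "- z"] assms
      by (simp add: linear_neg linear_0)
  qed
next
  assume nonneg: "\<forall>z. 0 \<le> z \<bullet> L z"
  show "convex_on UNIV (\<lambda>z. z \<bullet> L z)"
  proof (rule convex_onI)
    fix t :: real and x y :: 'a
    assume t: "0 < t" "t < 1"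
    have "(1 - t) * (x \<bullet> L x) + t * (y \<bullet> L y)
        - ((1 - t) *\<^sub>R x + t *\<^sub>R y) \<bullet> L ((1 - t) *\<^sub>R x + t *\<^sub>R y)
        = t * (1 - t) * ((x - y) \<bullet> L (x - y))"
      using assms
      by (simp add: linear_add linear_diff linear_scale inner_simps algebra_simps)
    moreover have "0 \<le> t * (1 - t) * ((x - y) \<bullet> L (x - y))"
      using t nonneg by simp
    ultimately show "((1 - t) *\<^sub>R x + t *\<^sub>R y) \<bullet> L ((1 - t) *\<^sub>R x + t *\<^sub>R y)
        \<le> (1 - t) * (x \<bullet> L x) + t * (y \<bullet> L y)"
      by linarith
  qed simp
qed

section \<open>Partial minimization by completing the square\<close>

lemma inner_matrix_transpose:
  fixes M :: "real^'n^'m"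
  shows "x \<bullet> (M *v y) = (transpose M *v x) \<bullet> y"
  by (metis dot_lmul_matrix transpose_matrix_vector transpose_transpose)

lemma matrix_mul_matrix_inv:
  fixes M :: "real^'n^'n"
  assumes "invertible M"
  shows "M ** matrix_inv M = mat 1"
  using someI_ex[OF assms[unfolded invertible_def]] by (simp add: matrix_inv_def)

lemma pd_imp_invertible:
  assumes "pd M"
  shows "invertible M"
proof -
  have "x = 0" if "M *v x = 0" for x
    using assms that unfolding pd_def by force
  then show ?thesis
    by (simp add: invertible_left_inverse matrix_left_invertible_ker)
qed

text \<open>The minimum over \<open>u\<close> is attained at \<open>u = - M\<^sup>-\<^sup>1 w\<close>, which gives one direction; the other one
  holds because the rest of the expression is the form of \<open>M\<close> at \<open>u + M\<^sup>-\<^sup>1 w\<close>.\<close>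

lemma quadratic_nonneg_iff_Schur:
  fixes M :: "real^'m^'m"
  assumes sym: "transpose M = M" and pd: "pd M"
  shows "(\<forall>u. 0 \<le> c + 2 * (w \<bullet> u) + u \<bullet> (M *v u)) \<longleftrightarrow> 0 \<le> c - w \<bullet> (matrix_inv M *v w)"
proof -
  define v where "v = matrix_inv M *v w"
  have "M ** matrix_inv M = mat 1"
    using pd_imp_invertible[OF pd] by (rule matrix_mul_matrix_inv)
  then have w: "w = M *v v"
    by (simp add: v_def matrix_vector_mul_assoc)
  have sym_form: "v \<bullet> (M *v u) = w \<bullet> u" for u
    using inner_matrix_transpose[of v M u] by (simp only: sym w)
  have square: "c + 2 * (w \<bullet> u) + u \<bullet> (M *v u)
      = (c - w \<bullet> v) + (u + v) \<bullet> (M *v (u + v))" for u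
    using inner_commute[of u w]
    by (simp add: matrix_vector_right_distrib w[symmetric] inner_add_left inner_add_right
        sym_form inner_commute[of v w])
  have "0 \<le> (u + v) \<bullet> (M *v (u + v))" for u
    using pd unfolding pd_def by (cases "u + v = 0") (auto intro: less_imp_le)
  moreover have "(- v + v) \<bullet> (M *v (- v + v)) = 0"
    by simp
  ultimately have "(\<forall>u. 0 \<le> c + 2 * (w \<bullet> u) + u \<bullet> (M *v u)) \<longleftrightarrow> 0 \<le> c - w \<bullet> v"
    unfolding square by (metis add.right_neutral add_nonneg_nonneg)
  then show ?thesis
    by (simp add: v_def)
qed

section \<open>Derivatives of the Krotov function\<close>

lemma state_gradient_quadratic_q:
  "state_gradient (quadratic_q P) x t = (P t + transpose (P t)) *v x"
proof -
  have "deriv (\<lambda>h. quadratic_q P (x + h *\<^sub>R axis i 1) t) 0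
      = ((P t + transpose (P t)) *v x) $ i" for i
  proof (rule DERIV_imp_deriv)
    let ?e = "axis i (1::real)"
    have "quadratic_q P (x + h *\<^sub>R ?e) t = x \<bullet> (P t *v x)
        + h * (((P t + transpose (P t)) *v x) \<bullet> ?e) + h * h * (?e \<bullet> (P t *v ?e))" for h
      by (simp add: quadratic_q_def matrix_vector_right_distrib matrix_vector_mult_add_rdistrib
          matrix_vector_mult_scaleR inner_simps inner_matrix_transpose[of x]
          inner_commute[of ?e "P t *v x"] algebra_simps)
    then show "((\<lambda>h. quadratic_q P (x + h *\<^sub>R ?e) t)
        has_field_derivative ((P t + transpose (P t)) *v x) $ i) (at 0)"
      by (auto intro!: derivative_eq_intros simp: inner_axis)
  qed
  then show ?thesis
    by (simp add: state_gradient_def vec_eq_iff)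
qed

lemma time_partial_quadratic_q:
  fixes P :: "real \<Rightarrow> real^'n^'n"
  assumes t: "t \<in> {t0..<tf}"
    and diff: "\<And>i j. (\<lambda>\<tau>. P \<tau> $ i $ j) differentiable (at t within {t0..tf})"
  shows "time_partial t0 tf (quadratic_q P) x t = x \<bullet> (entry_deriv t0 tf P t *v x)"
proof -
  have expand: "x \<bullet> (M *v x) = (\<Sum>i\<in>UNIV. \<Sum>j\<in>UNIV. x $ i * (M $ i $ j * x $ j))"
    for M :: "real^'n^'n"
    by (simp add: inner_vec_def matrix_vector_mult_def sum_distrib_left)
  have entry: "((\<lambda>\<tau>. P \<tau> $ i $ j) has_vector_derivative entry_deriv t0 tf P t $ i $ j)
      (at t within {t0..tf})" for i j
    using diff[of i j] by (simp add: entry_deriv_def vector_derivative_works)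
  have "((\<lambda>\<tau>. quadratic_q P x \<tau>) has_vector_derivative x \<bullet> (entry_deriv t0 tf P t *v x))
      (at t within {t0..tf})"
    unfolding quadratic_q_def expand
    by (intro has_vector_derivative_sum has_vector_derivative_mult_right
        has_vector_derivative_mult_left entry)
  then show ?thesis
    using t unfolding time_partial_def
    by (intro vector_derivative_within_cbox[of t0 tf, unfolded cbox_interval]) auto
qed

section \<open>Krotov's function for the regulator\<close>

text \<open>The cross term is written as \<open>2 * (w \<bullet> u)\<close> so that it has the shape needed for completing
  the square in \<open>u\<close>.\<close>

lemma krotov_s_quadratic_q:
  assumes "t \<in> {t0..<tf}"
    and "\<And>i j. (\<lambda>\<tau>. P \<tau> $ i $ j) differentiable (at t within {t0..tf})"
  shows "krotov_s t0 tf A B Q R (quadratic_q P) x u t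
     = x \<bullet> ((entry_deriv t0 tf P t + (P t + transpose (P t)) ** A t + Q t) *v x)
       + 2 * (((1/2) *\<^sub>R (transpose (B t) *v ((P t + transpose (P t)) *v x))) \<bullet> u) + u \<bullet> (R t *v u)"
proof -
  let ?S = "P t + transpose (P t)"
  have "transpose ?S = ?S"
    by (simp add: transpose_def vec_eq_iff)
  then have "x \<bullet> (?S *v (A t *v x)) = (?S *v x) \<bullet> (A t *v x)"
    using inner_matrix_transpose[of x ?S "A t *v x"] by (simp only:)
  moreover have "(?S *v x) \<bullet> (B t *v u) = (transpose (B t) *v (?S *v x)) \<bullet> u"
    by (rule inner_matrix_transpose)
  ultimately show ?thesis
    unfolding krotov_s_def state_gradient_quadratic_q time_partial_quadratic_q[OF assms]
    by (simp add: matrix_vector_mult_add_rdistrib[of _ "Q t"]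
        matrix_vector_mult_add_rdistrib[of "entry_deriv t0 tf P t"]
        matrix_vector_mul_assoc[symmetric] inner_add_right)
qed

lemma transpose_matrix_inv:
  fixes M :: "real^'n^'n"
  assumes sym: "transpose M = M" and inv: "invertible M"
  shows "transpose (matrix_inv M) = matrix_inv M"
proof -
  let ?K = "matrix_inv M"
  have right: "M ** ?K = mat 1"
    using inv by (rule matrix_mul_matrix_inv)
  have left: "transpose ?K ** M = mat 1"
    using arg_cong[OF right, of transpose] sym by (simp add: matrix_transpose_mul transpose_mat)
  have "transpose ?K = transpose ?K ** (M ** ?K)"
    by (simp only: right matrix_mul_rid)
  also have "\<dots> = ?K"
    by (simp only: matrix_mul_assoc left matrix_mul_lid)
  finally show ?thesis .
qed

text \<open>Here \<open>K\<close> plays the role of \<open>R\<^sup>-\<^sup>1\<close>, and the right side is what minimizing over \<open>u\<close>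
  leaves over. With \<open>a = B\<^sup>T P x\<close> and \<open>b = B\<^sup>T P\<^sup>T x\<close>, the three subtracted products on the
  left have the forms \<open>b \<bullet> K a\<close>, \<open>b \<bullet> K b\<close>, \<open>a \<bullet> K a\<close>, and the symmetry of \<open>K\<close> makes their
  weighted sum equal to \<open>1/4 (a + b) \<bullet> K (a + b)\<close>.\<close>

lemma krotov_inequality_form:
  fixes D A P Q :: "real^'n^'n" and B :: "real^'m^'n" and K :: "real^'m^'m"
  assumes K: "transpose K = K"
  shows "x \<bullet> ((D + P ** A + transpose A ** P + Q
           - (1/2) *\<^sub>R (P ** B ** K ** transpose B ** P)
           - (1/4) *\<^sub>R (P ** B ** K ** transpose B ** transpose P)
           - (1/4) *\<^sub>R (transpose P ** B ** K ** transpose B ** P)) *v x)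
     = x \<bullet> ((D + (P + transpose P) ** A + Q) *v x)
       - ((1/2) *\<^sub>R (transpose B *v ((P + transpose P) *v x)))
           \<bullet> (K *v ((1/2) *\<^sub>R (transpose B *v ((P + transpose P) *v x))))"
proof -
  define a where "a = transpose B *v (P *v x)"
  define b where "b = transpose B *v (transpose P *v x)"
  have KK: "b \<bullet> (K *v a) = a \<bullet> (K *v b)"
    using inner_matrix_transpose[of b K a] K by (simp add: inner_commute)
  have PA: "x \<bullet> ((transpose A ** P) *v x) = x \<bullet> ((transpose P ** A) *v x)"
    by (simp only: matrix_vector_mul_assoc[symmetric] inner_matrix_transpose[of x "transpose A"]
        inner_matrix_transpose[of x "transpose P"] transpose_transpose inner_commute)
  have PP: "x \<bullet> ((P ** B ** K ** transpose B ** P) *v x) = b \<bullet> (K *v a)"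
    and PT: "x \<bullet> ((P ** B ** K ** transpose B ** transpose P) *v x) = b \<bullet> (K *v b)"
    and TP: "x \<bullet> ((transpose P ** B ** K ** transpose B ** P) *v x) = a \<bullet> (K *v a)"
    unfolding a_def b_def
    by (simp_all only: matrix_vector_mul_assoc[symmetric] inner_matrix_transpose[of x P]
        inner_matrix_transpose[of x "transpose P"] inner_matrix_transpose[of _ B]
        transpose_transpose)
  have S: "transpose B *v ((P + transpose P) *v x) = a + b"
    by (simp add: a_def b_def matrix_vector_mult_add_rdistrib matrix_vector_right_distrib)
  have D: "(P + transpose P) ** A = P ** A + transpose P ** A"
    by (simp add: matrix_matrix_mult_def vec_eq_iff distrib_right sum.distrib)
  have scale: "(c *\<^sub>R M) *v x = c *\<^sub>R (M *v x)" for c and M :: "real^'n^'n"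
    by (simp add: scaleR_matrix_vector_assoc)
  show ?thesis
    unfolding S D
    by (simp add: matrix_vector_mult_add_rdistrib matrix_vector_mult_diff_rdistrib scale
        inner_add_right inner_diff_right PA PP PT TP matrix_vector_right_distrib
        matrix_vector_mult_scaleR inner_add_left KK field_simps)
qed

theorem proposition1:
  fixes t0 tf :: real
    and A Q P :: "real \<Rightarrow> real^'n^'n"
    and B :: "real \<Rightarrow> real^'m^'n"
    and R :: "real \<Rightarrow> real^'m^'m"
    and F :: "real \<Rightarrow> real^'n^'n"
  assumes "t0 < tf"
    and "\<And>t. t \<in> {t0..tf} \<Longrightarrow> transpose (Q t) = Q t"
    and "\<And>t. t \<in> {t0..tf} \<Longrightarrow> psd (Q t)"
    and "\<And>t. t \<in> {t0..tf} \<Longrightarrow> transpose (R t) = R t"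
    and "\<And>t. t \<in> {t0..tf} \<Longrightarrow> pd (R t)"
    and "transpose (F tf) = F tf"
    and "\<And>t i j. t \<in> {t0..<tf} \<Longrightarrow>
           (\<lambda>\<tau>. P \<tau> $ i $ j) differentiable (at t within {t0..tf})"
  shows
    "((\<forall>t\<in>{t0..<tf}. convex_on UNIV
          (\<lambda>(x::real^'n, u::real^'m). krotov_s t0 tf A B Q R (quadratic_q P) x u t))
      \<and> convex_on UNIV (krotov_sf tf (F tf) (quadratic_q P)))
     \<longleftrightarrow>
     ((\<forall>t\<in>{t0..<tf}. psd
          (entry_deriv t0 tf P t + P t ** A t + transpose (A t) ** P t + Q t
           - (1/2) *\<^sub>R (P t ** B t ** matrix_inv (R t) ** transpose (B t) ** P t)
           - (1/4) *\<^sub>R (P t ** B t ** matrix_inv (R t) ** transpose (B t) ** transpose (P t))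
           - (1/4) *\<^sub>R (transpose (P t) ** B t ** matrix_inv (R t) ** transpose (B t) ** P t)))
      \<and> psd (F tf - P tf))"
proof -
  have running: "convex_on UNIV
        (\<lambda>(x::real^'n, u::real^'m). krotov_s t0 tf A B Q R (quadratic_q P) x u t) \<longleftrightarrow>
      psd (entry_deriv t0 tf P t + P t ** A t + transpose (A t) ** P t + Q t
           - (1/2) *\<^sub>R (P t ** B t ** matrix_inv (R t) ** transpose (B t) ** P t)
           - (1/4) *\<^sub>R (P t ** B t ** matrix_inv (R t) ** transpose (B t) ** transpose (P t))
           - (1/4) *\<^sub>R (transpose (P t) ** B t ** matrix_inv (R t) ** transpose (B t) ** P t))"
    if t: "t \<in> {t0..<tf}" for t
  proof -
    have R: "transpose (R t) = R t" "pd (R t)"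
      using t assms(4,5) by auto
    define M where "M = entry_deriv t0 tf P t + (P t + transpose (P t)) ** A t + Q t"
    define w where "w x = (1/2) *\<^sub>R (transpose (B t) *v ((P t + transpose (P t)) *v x))" for x
    define N where "N = (P t + transpose (P t)) ** B t"
    define L where "L = (\<lambda>(x::real^'n, u::real^'m). (M *v x + N *v u, R t *v u))"
    have s: "krotov_s t0 tf A B Q R (quadratic_q P) x u t
        = x \<bullet> (M *v x) + 2 * (w x \<bullet> u) + u \<bullet> (R t *v u)" for x u
      unfolding M_def w_def using t assms(7) by (intro krotov_s_quadratic_q) auto
    \<comment> \<open>The joint form in \<open>(x,u)\<close> is not given by a symmetric operator: \<open>L\<close> carries the whole
      cross term in its first component, which suffices because only \<open>z \<bullet> L z\<close> matters.\<close>
    have "transpose (P t + transpose (P t)) = P t + transpose (P t)"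
      by (simp add: transpose_def vec_eq_iff)
    then have "2 * (w x \<bullet> u) = x \<bullet> (N *v u)" for x u
      by (simp add: w_def inner_matrix_transpose[of x] N_def matrix_transpose_mul
          matrix_vector_mul_assoc)
    then have form: "(\<lambda>(x, u). krotov_s t0 tf A B Q R (quadratic_q P) x u t) = (\<lambda>z. z \<bullet> L z)"
      by (auto simp: fun_eq_iff s L_def inner_add_right)
    have "linear L"
      by (rule linearI) (auto simp: L_def matrix_vector_right_distrib
          matrix_vector_mult_scaleR scaleR_add_right)
    then have "convex_on UNIV (\<lambda>(x, u). krotov_s t0 tf A B Q R (quadratic_q P) x u t)
        \<longleftrightarrow> (\<forall>z. 0 \<le> (\<lambda>(x, u). krotov_s t0 tf A B Q R (quadratic_q P) x u t) z)"
      unfolding form by (rule convex_on_quadratic_form_iff)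
    also have "\<dots> \<longleftrightarrow> (\<forall>x. \<forall>u. 0 \<le> x \<bullet> (M *v x) + 2 * (w x \<bullet> u) + u \<bullet> (R t *v u))"
      by (simp add: s)
    also have "\<dots> \<longleftrightarrow> (\<forall>x. 0 \<le> x \<bullet> (M *v x) - w x \<bullet> (matrix_inv (R t) *v w x))"
      by (simp only: quadratic_nonneg_iff_Schur[OF R])
    finally show ?thesis
      unfolding psd_def M_def w_def
      by (simp only: krotov_inequality_form transpose_matrix_inv R pd_imp_invertible)
  qed
  have "krotov_sf tf (F tf) (quadratic_q P) = (\<lambda>x. x \<bullet> ((F tf - P tf) *v x))"
    by (simp add: fun_eq_iff krotov_sf_def quadratic_q_def matrix_vector_mult_diff_rdistrib
        inner_diff_right)
  then have "convex_on UNIV (krotov_sf tf (F tf) (quadratic_q P)) \<longleftrightarrow> psd (F tf - P tf)"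
    by (simp add: convex_on_quadratic_form_iff psd_def)
  with running show ?thesis
    by simp
qed

end
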